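(* Let $a\ge 0$ be real and $k\in\mathbb{N}\setminus\{1\}$. Then $$\sum_{n=1}^\infty\frac{H_n^2}{\binom{n+k+a}{k}}=k\sum_{r=1}^{k-1}(-1)^{r+1}\binom{k-1}{r}\left\{\begin{aligned}&\zeta(2)H_r^{(1)}(a)-H_{a+1}H_r^{(2)}(a)\\&-\sum_{i=1}^{r-1}\frac{H_i^{(1)}(a+1)}{(i+a+1)^2}+\sum_{j=1}^r\frac{H_{a+j}^2+H_{a+j}^{(2)}}{a+j}\end{aligned}\right\}.$$
   Context: $\mathbb{N}=\{1,2,3,\ldots\}$. For $n\in\mathbb{N}$, $H_n=\sum_{j=1}^n \frac1j$. Shifted harmonic numbers: for $\alpha\in\mathbb{C}\setminus\{-1,-2,\ldots\}$, $H_\alpha=\psi(\alpha+1)+\gamma=\sum_{l=1}^\infty\left(\frac1l-\frac1{l+\alpha}\right)$ ($\psi$ the digamma function, $\gamma$ the Euler–Mascheroni constant) and $H_\alpha^{(2)}=\zeta(2)-\zeta(2,\alpha+1)$, where $\zeta(s,c)=\sum_{n=0}^\infty (n+c)^{-s}$ is the Hurwitz zeta function and $\zeta$ the Riemann zeta function. Parametric harmonic numbers: $H_n^{(s)}(c)=\sum_{j=1}^n (j+c)^{-s}$ for $n\ge 0$, $c\in\mathbb{C}\setminus\{-1,-2,\ldots\}$. For real or complex $u$ and $k\in\mathbb{N}$, $\binom{u}{k}=\frac{u(u-1)\cdots(u-k+1)}{k!}$. Empty sums are $0$. *)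

theory Defs
  imports "HOL-Analysis.Analysis"
begin

(* All functions below are polymorphic, with a real and a complex instance.  On the complex
   numbers, powr uses the principal branch.  The real powr agrees with it for positive bases only,
   so real instances are to be read with c > 0 in hurwitz_zeta, with alpha > -1 in
   shifted_harm2, and with c > -1 in parametric_harm. *)

(* Series definitions, meaningful for Re s > 1 only (no analytic continuation). *)

definition hurwitz_zeta :: "'a \<Rightarrow> 'a \<Rightarrow> 'a::{real_normed_field, banach, ln}" where
  "hurwitz_zeta s c = (\<Sum>n. (of_nat n + c) powr (- s))"

definition riemann_zeta :: "'a \<Rightarrow> 'a::{real_normed_field, banach, ln}" where
  "riemann_zeta s = (\<Sum>n. of_nat (Suc n) powr (- s))"

(* For a natural number n, the usual harmonic number is the library's harm n. *)

definition shifted_harm :: "'a \<Rightarrow> 'a::{real_normed_field, banach}" where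
  "shifted_harm \<alpha> = Digamma (\<alpha> + 1) + euler_mascheroni"

definition shifted_harm2 :: "'a \<Rightarrow> 'a::{real_normed_field, banach, ln}" where
  "shifted_harm2 \<alpha> = riemann_zeta 2 - hurwitz_zeta 2 (\<alpha> + 1)"

definition parametric_harm :: "nat \<Rightarrow> 'a \<Rightarrow> 'a \<Rightarrow> 'a::{real_normed_field, banach, ln}" where
  "parametric_harm n s c = (\<Sum>j = 1..n. (of_nat j + c) powr (- s))"

end

theory Submission
  imports Defs "HOL-Real_Asymp.Real_Asymp"
begin

text \<open>
  The denominator splits into partial fractions,
  \[ \frac{1}{\binom{n+k+a}{k}} = k \sum_{r=1}^{k-1} (-1)^{r+1} \binom{k-1}{r}
       \left(\frac{1}{n+a+1} - \frac{1}{n+a+r+1}\right), \]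
  where the first term in each bracket comes for free because the alternating binomial
  coefficients add up to 0. It is what makes the individual series converge. The bracket
  telescopes into $r$ differences, so everything reduces to
  \[ T_b = \sum_{n \ge 1} H_n^2 \left(\frac{1}{n+b} - \frac{1}{n+b+1}\right), \qquad b = a + j > 0. \]
  Summation by parts turns $T_b$ into the series of $(H_n^2 - H_{n-1}^2)/(n+b)$, that is, into
  the linear Euler sum $\sum_n H_n u_n$ and simpler series, where $u_n = 1/n - 1/(n+b)$ are the
  terms of the series for $H_b$.

  The evaluation of $\sum_n H_n u_n$ is the heart of the matter. Put
  $A_n = \sum_{j \le n} 1/(j+b)$, so that the partial sums of the $u_n$ are $H_n - A_n$.
  Squaring the series for $H_b$ and telescoping the squares of its partial sums gives
  \[ H_b^2 = 2 \sum_n u_n H_n - 2 \sum_n u_n A_n - \sum_n u_n^2. \]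
  The middle series has the value $H_b^{(2)}$ (lemma \<open>parametric_harm_times_harm_term_sums\<close>):
  this follows from summing $b/(m (m+n) (n+b))$ over all positive $m$, $n$ in two ways. For
  fixed $n$ the sum over $m$ is $H_n u_n$; collecting the terms with $m + n = q$ instead gives
  $(H_{q-1} + A_{q-1}) u_q$. Hence $\sum_q u_q A_{q-1} = \sum_q u_q / q$, where the unknown
  $\sum_n H_n u_n$ has cancelled, and adding $u_q/(q+b)$ to the terms on both sides gives
  $\sum_q u_q A_q = \sum_q (1/q^2 - 1/(q+b)^2) = H_b^{(2)}$. The value of
  $\sum_n u_n H_n$ then follows from the displayed equation.

  All infinite series are indexed from 0, so that an index \<open>n\<close> there stands for
  $n + 1$ in these formulas.
\<close>

section \<open>Shifted harmonic numbers as series and finite sums\<close>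

text \<open>The numbers $u_{n+1}$, the general term of the series for $H_b$.\<close>

definition harm_term :: "real \<Rightarrow> nat \<Rightarrow> real" where
  "harm_term b n = 1 / real (Suc n) - 1 / (real (Suc n) + b)"

lemma harm_term_eq:
  assumes "b \<ge> 0"
  shows "harm_term b n = b / (real (Suc n) * (real (Suc n) + b))"
  using assms by (simp add: harm_term_def field_simps del: of_nat_Suc)

lemma harm_term_nonneg: "b \<ge> 0 \<Longrightarrow> harm_term b n \<ge> 0"
  by (simp add: harm_term_eq)

lemma harm_term_sums:
  assumes "b \<ge> 0"
  shows "harm_term b sums shifted_harm b"
proof -
  have "(\<lambda>n. inverse (real (Suc n)) - inverse ((b + 1) + real n)) sums
          (Digamma (b + 1) + euler_mascheroni)"
    using summable_Digamma[of "b + 1"] assms by (simp add: Digamma_def summable_sums)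
  thus ?thesis
    by (simp add: harm_term_def[abs_def] shifted_harm_def inverse_eq_divide algebra_simps)
qed

text \<open>For a natural number $b$, the series for $H_b$ thus becomes an expansion of \<^const>\<open>harm\<close>.\<close>

lemma shifted_harm_of_nat: "shifted_harm (real n) = harm n"
  using Digamma_of_nat[of n, where 'a = real] by (simp add: shifted_harm_def add.commute)

lemma parametric_harm_1_Suc:
  assumes "c > (-1 :: real)"
  shows "parametric_harm (Suc n) 1 c = parametric_harm n 1 c + 1 / (real (Suc n) + c)"
  using assms by (simp add: parametric_harm_def powr_minus_divide)

lemma parametric_harm_1_eq:
  assumes "c > (-1 :: real)"
  shows "parametric_harm n 1 c = (\<Sum>j = 1..n. 1 / (real j + c))"
  using assms by (auto simp: parametric_harm_def powr_minus_divide intro!: sum.cong)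

lemma parametric_harm_2_eq:
  assumes "c > (-1 :: real)"
  shows "parametric_harm n 2 c = (\<Sum>j = 1..n. 1 / (real j + c)\<^sup>2)"
  using assms by (auto simp: parametric_harm_def powr_minus_divide intro!: sum.cong)

lemma sum_harm_term:
  assumes "b \<ge> 0"
  shows "(\<Sum>m<n. harm_term b m) = harm n - parametric_harm n 1 b"
  using assms
  by (induction n)
     (simp_all add: parametric_harm_1_Suc harm_Suc harm_term_def inverse_eq_divide,
      simp add: parametric_harm_def harm_def)

lemma shifted_harm_add_nat:
  assumes "b \<ge> 0"
  shows "shifted_harm (b + real n) = shifted_harm b + parametric_harm n 1 b"
proof (induction n)
  case 0
  show ?case by (simp add: parametric_harm_def)
next
  case (Suc n)
  have "Digamma ((b + real n + 1) + 1) = Digamma (b + real n + 1) + 1 / (b + real n + 1)"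
    using assms by (intro Digamma_plus1) auto
  with Suc assms show ?case
    by (simp add: shifted_harm_def parametric_harm_1_Suc algebra_simps)
qed

lemma inverse_squares_sums_zeta: "(\<lambda>n. 1 / (real (Suc n))\<^sup>2) sums riemann_zeta 2"
proof -
  have "summable (\<lambda>n. 1 / (real (Suc n))\<^sup>2)"
    using inverse_squares_sums by (auto simp: sums_iff add.commute)
  thus ?thesis
    by (simp add: riemann_zeta_def powr_minus_divide summable_sums del: of_nat_Suc)
qed

lemma shifted_inverse_squares_sums_zeta:
  assumes "b \<ge> (0 :: real)"
  shows "(\<lambda>n. 1 / (real (Suc n) + b)\<^sup>2) sums hurwitz_zeta 2 (b + 1)"
proof -
  have "summable (\<lambda>n. 1 / (real (Suc n) + b)\<^sup>2)"
  proof (rule summable_comparison_test)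
    show "\<exists>N. \<forall>n\<ge>N. norm (1 / (real (Suc n) + b)\<^sup>2) \<le> 1 / (real (Suc n))\<^sup>2"
      using assms by (intro exI[of _ 0] allI impI) (auto intro!: divide_left_mono power_mono)
    show "summable (\<lambda>n. 1 / (real (Suc n))\<^sup>2)"
      using inverse_squares_sums_zeta by (rule sums_summable)
  qed
  moreover have "(\<lambda>n. (real n + (b + 1)) powr (- 2)) = (\<lambda>n. 1 / (real (Suc n) + b)\<^sup>2)"
    using assms by (auto simp: powr_minus_divide algebra_simps)
  ultimately show ?thesis
    by (simp only: hurwitz_zeta_def summable_sums)
qed

lemma shifted_harm2_sums:
  assumes "b \<ge> (0 :: real)"
  shows "(\<lambda>n. 1 / (real (Suc n))\<^sup>2 - 1 / (real (Suc n) + b)\<^sup>2) sums shifted_harm2 b"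
  unfolding shifted_harm2_def
  by (intro sums_diff inverse_squares_sums_zeta shifted_inverse_squares_sums_zeta assms)

text \<open>
  Expanding the square of $1/x - 1/y$ leaves the mixed term $2/(xy)$, which is
  $2(1/x - 1/y)/(y - x)$ with the constant gap $y - x = b$; so the mixed terms add up to a
  multiple of $H_b$.
\<close>

lemma harm_term_square_sums:
  assumes "b > 0"
  shows "(\<lambda>n. (harm_term b n)\<^sup>2) sums (2 * riemann_zeta 2 - shifted_harm2 b - 2 * shifted_harm b / b)"
proof -
  have "(\<lambda>n. 2 * (1 / (real (Suc n))\<^sup>2) - (1 / (real (Suc n))\<^sup>2 - 1 / (real (Suc n) + b)\<^sup>2)
            - 2 * harm_term b n / b) sums
          (2 * riemann_zeta 2 - shifted_harm2 b - 2 * shifted_harm b / b)"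
    using assms
    by (intro sums_diff sums_mult sums_divide inverse_squares_sums_zeta shifted_harm2_sums
              harm_term_sums) auto
  moreover have "2 * (1 / (real (Suc n))\<^sup>2) - (1 / (real (Suc n))\<^sup>2 - 1 / (real (Suc n) + b)\<^sup>2)
            - 2 * harm_term b n / b = (harm_term b n)\<^sup>2" for n
  proof -
    have "1/x\<^sup>2 + 1/y\<^sup>2 - 2 * (1 / x - 1 / y) / (y - x) = (1/x - 1/y)\<^sup>2"
      if "x > 0" "y > x" for x y :: real
    proof -
      have "2 * (1 / x - 1 / y) / (y - x) = 2 / (x * y)" using that by (simp add: field_simps)
      thus ?thesis by (simp add: power2_diff power_divide)
    qed
    from this[of "real (Suc n)" "real (Suc n) + b"] assms show ?thesis
      by (simp add: harm_term_def del: of_nat_Suc)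
  qed
  ultimately show ?thesis by simp
qed

section \<open>Logarithmic growth\<close>

text \<open>
  Any exponent below $1/2$ serves here: it makes $H_n^2/n$ vanish in the limit and
  $H_n/n^2$ summable.
\<close>

lemma harm_bigo: "(\<lambda>n. harm (Suc n)) \<in> O(\<lambda>n. real (Suc n) powr (1 / 4))"
proof -
  have "(\<lambda>n. harm n - ln (real n)) \<in> O(\<lambda>_. 1 :: real)"
    by (rule bigoI_tendsto[where c = euler_mascheroni])
       (use euler_mascheroni_LIMSEQ in simp_all)
  also have "(\<lambda>_::nat. 1 :: real) \<in> O(\<lambda>n. real n powr (1 / 4))" by real_asymp
  finally have "(\<lambda>n. (harm n - ln (real n)) + ln (real n)) \<in> O(\<lambda>n. real n powr (1 / 4))"
    by (rule sum_in_bigo) real_asymp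
  hence "harm \<in> O(\<lambda>n. real n powr (1 / 4))" by simp
  from landau_o.big.compose[OF this filterlim_Suc] show ?thesis .
qed

lemma harm_square_over_linear_tendsto_0:
  assumes "b \<ge> 0"
  shows "(\<lambda>n. (harm n)\<^sup>2 / (real (Suc n) + b)) \<longlonglongrightarrow> 0"
proof -
  have "(\<lambda>n. (harm (Suc n))\<^sup>2 / (real (Suc (Suc n)) + b)) \<in>
          O(\<lambda>n. (real (Suc n) powr (1 / 4))\<^sup>2 / (real (Suc (Suc n)) + b))"
    using assms by (intro landau_o.big.divide_right landau_o.big_power harm_bigo) auto
  also have "(\<lambda>n. (real (Suc n) powr (1 / 4))\<^sup>2 / (real (Suc (Suc n)) + b)) \<in> o(\<lambda>_. 1)"
    by real_asymp
  finally have "(\<lambda>n. (harm (Suc n))\<^sup>2 / (real (Suc (Suc n)) + b)) \<longlonglongrightarrow> 0"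
    by (auto dest: smalloD_tendsto)
  thus ?thesis by (rule LIMSEQ_imp_Suc)
qed

lemma summable_harm_times_harm_term:
  assumes "b \<ge> 0"
  shows "summable (\<lambda>n. harm (Suc n) * harm_term b n)"
proof (rule summable_comparison_test_bigo)
  show "summable (\<lambda>n. norm (real n powr (-3/2)))"
    by (simp add: summable_real_powr_iff)
  have "(\<lambda>n. harm (Suc n) * harm_term b n) \<in>
          O(\<lambda>n. real (Suc n) powr (1 / 4) * (b / (real (Suc n) * (real (Suc n) + b))))"
    using assms by (intro landau_o.big.mult harm_bigo) (simp add: harm_term_eq)
  also have "(\<lambda>n. real (Suc n) powr (1 / 4) * (b / (real (Suc n) * (real (Suc n) + b))))
      \<in> O(\<lambda>n. real n powr (-3/2))"
    by real_asymp
  finally show "(\<lambda>n. harm (Suc n) * harm_term b n) \<in> O(\<lambda>n. real n powr (-3/2))" .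
qed

section \<open>Quadratic Euler sums\<close>

text \<open>
  One antidiagonal of the double series: since $(q - i) + (i + 1 + b) = q + 1 + b$ does not
  depend on $i$, the product of the two factors that do splits into partial fractions with a
  common coefficient.
\<close>

lemma harm_term_convolution:
  assumes "b \<ge> 0"
  shows "(\<Sum>i<q. b / (real (q - i) * real (Suc q) * (real (Suc i) + b)))
           = (harm q + parametric_harm q 1 b) * harm_term b q"
proof -
  have "b / (real (q - i) * real (Suc q) * (real (Suc i) + b))
          = (1 / real (q - i) + 1 / (real (Suc i) + b)) * harm_term b q" if "i < q" for i
  proof -
    have *: "x + y = z \<Longrightarrow> x > 0 \<Longrightarrow> y > 0 \<Longrightarrow> w > 0 \<Longrightarrow>
             b / (x * w * y) = (1/x + 1/y) * (b / (w * z))" for x y z w :: real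
      by (simp add: divide_simps)
    show ?thesis
      unfolding harm_term_eq[OF assms] by (rule *) (use that assms in \<open>auto simp: of_nat_diff\<close>)
  qed
  hence "(\<Sum>i<q. b / (real (q - i) * real (Suc q) * (real (Suc i) + b)))
           = (\<Sum>i<q. (1 / real (q - i) + 1 / (real (Suc i) + b)) * harm_term b q)"
    by (intro sum.cong) auto
  also have "\<dots> = ((\<Sum>i<q. 1 / real (q - i)) + (\<Sum>i<q. 1 / (real (Suc i) + b))) * harm_term b q"
    by (simp only: sum_distrib_right sum.distrib distrib_right)
  also have "(\<Sum>i<q. 1 / real (q - i)) = harm q"
    unfolding harm_def
    by (rule sum.reindex_bij_witness[of _ "\<lambda>j. q - j" "\<lambda>i. q - i"]) (auto simp: inverse_eq_divide)
  also have "(\<Sum>i<q. 1 / (real (Suc i) + b)) = parametric_harm q 1 b"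
    using assms by (subst parametric_harm_1_eq) (auto simp: sum.atLeast1_atMost_eq)
  finally show ?thesis .
qed

text \<open>
  The terms of the double series are nonnegative, so it may be summed in either order as soon
  as the iterated sum in one order converges. Its value \<open>S\<close> is the Euler sum that is still
  unknown, but it occurs on both sides and cancels.
\<close>

lemma parametric_harm_times_harm_term_sums:
  assumes "b \<ge> 0"
  shows "(\<lambda>n. parametric_harm (Suc n) 1 b * harm_term b n) sums shifted_harm2 b"
proof -
  \<comment> \<open>The double series in the variables \<open>i = n - 1\<close> and \<open>q = m + n - 1\<close>, summed over \<open>i < q\<close>.\<close>
  define f where "f = (\<lambda>(i, q). b / (real (q - i) * real (Suc q) * (real (Suc i) + b)))"
  define S where "S = (\<Sum>n. harm (Suc n) * harm_term b n)"
  have S: "(\<lambda>n. harm (Suc n) * harm_term b n) sums S"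
    unfolding S_def by (intro summable_sums summable_harm_times_harm_term assms)
  have S': "((\<lambda>n. harm (Suc n) * harm_term b n) has_sum S) UNIV"
    using S harm_term_nonneg[OF assms] by (intro sums_nonneg_imp_has_sum) (auto simp: harm_nonneg)
  have f_nonneg: "f (i, q) \<ge> 0" for i q
    using assms by (simp add: f_def)
  have rows: "((\<lambda>q. f (i, q)) has_sum (harm (Suc i) * harm_term b i)) {i<..}" for i
  proof -
    \<comment> \<open>$H_{i+1}$ itself is the sum over \<open>m\<close> of $1/m - 1/(m+i+1)$.\<close>
    have "harm_term (real (Suc i)) sums harm (Suc i)"
      using harm_term_sums[of "real (Suc i)"] unfolding shifted_harm_of_nat by simp
    hence "(\<lambda>m. harm_term (real (Suc i)) m * (harm_term b i)) sums (harm (Suc i) * harm_term b i)"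
      by (rule sums_mult2)
    also have "(\<lambda>m. harm_term (real (Suc i)) m * harm_term b i) = (\<lambda>m. f (i, Suc i + m))"
      using assms by (auto simp: fun_eq_iff f_def harm_term_eq add_ac simp del: of_nat_Suc)
    finally have "((\<lambda>m. f (i, Suc i + m)) has_sum (harm (Suc i) * harm_term b i)) UNIV"
      using f_nonneg by (intro sums_nonneg_imp_has_sum) auto
    thus ?thesis
      by (subst has_sum_reindex_bij_witness[of _ "\<lambda>m. Suc i + m" "\<lambda>q. q - Suc i" UNIV
              "\<lambda>m. f (i, Suc i + m)"]) auto
  qed
  have "f summable_on (SIGMA i:UNIV. {i<..})"
    using rows S' f_nonneg by (intro summable_on_SigmaI) (auto simp: summable_on_def)
  hence "(f has_sum S) (SIGMA i:UNIV. {i<..})"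
    using rows S' by (intro has_sum_SigmaI)
  hence "((\<lambda>(q, i). f (i, q)) has_sum S) (SIGMA q:UNIV. {..<q})"
    by (subst has_sum_reindex_bij_witness[of _ "\<lambda>(i, q). (q, i)" "\<lambda>(q, i). (i, q)"
              "SIGMA i:UNIV. {i<..}" f]) auto
  hence "((\<lambda>q. (harm q + parametric_harm q 1 b) * harm_term b q) has_sum S) UNIV"
    by (rule has_sum_SigmaD)
       (auto intro!: has_sum_finiteI simp: f_def harm_term_convolution[OF assms, symmetric])
  hence "(\<lambda>q. (harm q + parametric_harm q 1 b) * harm_term b q) sums S"
    by (rule has_sum_imp_sums)
  \<comment> \<open>What is left after cancelling \<open>S\<close> falls short of the claimed terms by
      $u_q (1/q + 1/(q+b)) = 1/q^2 - 1/(q+b)^2$, whose series is known.\<close>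
  from sums_diff[OF this S] have
    "(\<lambda>n. (harm n + parametric_harm n 1 b) * harm_term b n - harm (Suc n) * harm_term b n) sums 0"
    by simp
  from sums_add[OF this shifted_harm2_sums[OF assms]]
  have "(\<lambda>n. (harm n + parametric_harm n 1 b) * harm_term b n - harm (Suc n) * harm_term b n +
            (1 / (real (Suc n))\<^sup>2 - 1 / (real (Suc n) + b)\<^sup>2)) sums shifted_harm2 b"
    by simp
  also have "(\<lambda>n. (harm n + parametric_harm n 1 b) * harm_term b n - harm (Suc n) * harm_term b n +
                (1 / (real (Suc n))\<^sup>2 - 1 / (real (Suc n) + b)\<^sup>2)) =
             (\<lambda>n. parametric_harm (Suc n) 1 b * harm_term b n)"
  proof
    fix n
    have "1 / (real (Suc n))\<^sup>2 - 1 / (real (Suc n) + b)\<^sup>2 =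
            (1 / real (Suc n) + 1 / (real (Suc n) + b)) * harm_term b n"
      by (simp add: harm_term_def algebra_simps power2_eq_square)
    thus "(harm n + parametric_harm n 1 b) * harm_term b n - harm (Suc n) * harm_term b n +
            (1 / (real (Suc n))\<^sup>2 - 1 / (real (Suc n) + b)\<^sup>2) =
          parametric_harm (Suc n) 1 b * harm_term b n"
      using assms by (simp add: parametric_harm_1_Suc harm_Suc inverse_eq_divide algebra_simps)
  qed
  finally show ?thesis .
qed

text \<open>
  The partial sums \<open>U\<close> of the series for $H_b$ satisfy
  $U_{n+1}^2 - U_n^2 = 2 u_n U_{n+1} - u_n^2$, and $U_{n+1}$ is a difference of two harmonic
  sums. Solving the telescoped identity for the one unknown series gives the value.
\<close>

lemma harm_times_harm_term_sums:
  assumes "b > 0"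
  shows "(\<lambda>n. harm (Suc n) * harm_term b n) sums
           (((shifted_harm b)\<^sup>2 + shifted_harm2 b) / 2 + riemann_zeta 2 - shifted_harm b / b)"
proof -
  define U where "U = (\<lambda>n. \<Sum>m<n. harm_term b m)"
  have "U \<longlonglongrightarrow> shifted_harm b"
    using harm_term_sums[of b] assms by (simp add: sums_def U_def)
  hence "(\<lambda>n. (U (Suc n))\<^sup>2 - (U n)\<^sup>2) sums ((shifted_harm b)\<^sup>2 - (U 0)\<^sup>2)"
    by (intro telescope_sums tendsto_power)
  from sums_add[OF sums_add[OF this sums_mult[of _ _ 2, OF parametric_harm_times_harm_term_sums[of b]]]
         harm_term_square_sums[OF assms]] assms
  have "(\<lambda>n. ((U (Suc n))\<^sup>2 - (U n)\<^sup>2 + 2 * (parametric_harm (Suc n) 1 b * harm_term b n) +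
                (harm_term b n)\<^sup>2) / 2) sums
          (((shifted_harm b)\<^sup>2 + 2 * shifted_harm2 b +
             (2 * riemann_zeta 2 - shifted_harm2 b - 2 * shifted_harm b / b)) / 2)"
    by (intro sums_divide) (simp add: U_def)
  also have "(\<lambda>n. ((U (Suc n))\<^sup>2 - (U n)\<^sup>2 + 2 * (parametric_harm (Suc n) 1 b * harm_term b n) +
                (harm_term b n)\<^sup>2) / 2) = (\<lambda>n. harm (Suc n) * harm_term b n)"
  proof
    fix n
    have A: "parametric_harm (Suc n) 1 b = harm (Suc n) - U (Suc n)" and U: "U n = U (Suc n) - harm_term b n"
      using sum_harm_term[of b "Suc n"] assms by (simp_all add: U_def)
    show "((U (Suc n))\<^sup>2 - (U n)\<^sup>2 + 2 * (parametric_harm (Suc n) 1 b * harm_term b n) +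
             (harm_term b n)\<^sup>2) / 2 = harm (Suc n) * harm_term b n"
      unfolding A U by (simp add: power2_eq_square algebra_simps)
  qed
  finally show ?thesis by (simp add: field_simps)
qed

text \<open>
  Summation by parts moves the difference from $1/(n+b)$ to $H_n^2$, where it is only
  $2 H_n/n - 1/n^2$; the boundary term vanishes because $H_n$ grows logarithmically.
\<close>

lemma harm_square_telescoping_sums:
  assumes "b > 0"
  shows "(\<lambda>n. (harm (Suc n))\<^sup>2 * (1 / (real (Suc n) + b) - 1 / (real (Suc n) + b + 1))) sums
           ((riemann_zeta 2 + (shifted_harm b)\<^sup>2 + shifted_harm2 b) / b - shifted_harm b / b\<^sup>2)"
proof -
  let ?Z = "riemann_zeta 2" and ?H = "shifted_harm b" and ?H2 = "shifted_harm2 b"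
  have abel: "(\<Sum>n<N. (harm (Suc n))\<^sup>2 * (1 / (real (Suc n) + b) - 1 / (real (Suc n) + b + 1)))
      = (\<Sum>n<N. ((harm (Suc n))\<^sup>2 - (harm n)\<^sup>2) / (real (Suc n) + b))
          - (harm N)\<^sup>2 / (real (Suc N) + b)" for N
    by (induction N) (simp_all add: harm_expand algebra_simps diff_divide_distrib)
  have incr: "((harm (Suc n))\<^sup>2 - (harm n)\<^sup>2) / (real (Suc n) + b)
     = (2 * (harm (Suc n) * harm_term b n) - (1 / (real (Suc n))\<^sup>2 - harm_term b n / b)) / b" for n
  proof -
    have *: "(h\<^sup>2 - (h - 1 / x)\<^sup>2) / (x + b)
              = (2 * (h * (b / (x * (x + b)))) - (1 / x\<^sup>2 - b / (x * (x + b)) / b)) / b"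
      if "x > 0" for h x :: real
      using that assms by (simp add: divide_simps) (simp add: algebra_simps power2_eq_square)
    have "harm n = harm (Suc n) - 1 / real (Suc n)"
      by (simp add: harm_Suc inverse_eq_divide)
    thus ?thesis
      using *[of "real (Suc n)" "harm (Suc n)"] assms by (simp add: harm_term_eq)
  qed
  have "(\<lambda>n. ((harm (Suc n))\<^sup>2 - (harm n)\<^sup>2) / (real (Suc n) + b)) sums
          ((2 * ((?H\<^sup>2 + ?H2) / 2 + ?Z - ?H / b) - (?Z - ?H / b)) / b)"
    unfolding incr using assms
    by (intro sums_divide sums_diff sums_mult harm_times_harm_term_sums inverse_squares_sums_zeta
          harm_term_sums) auto
  from tendsto_diff[OF this[unfolded sums_def] harm_square_over_linear_tendsto_0[of b]] assms
  have "(\<lambda>n. (harm (Suc n))\<^sup>2 * (1 / (real (Suc n) + b) - 1 / (real (Suc n) + b + 1))) sums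
          ((2 * ((?H\<^sup>2 + ?H2) / 2 + ?Z - ?H / b) - (?Z - ?H / b)) / b)"
    unfolding sums_def abel by simp
  also have "(2 * ((?H\<^sup>2 + ?H2) / 2 + ?Z - ?H / b) - (?Z - ?H / b)) / b
               = (?Z + ?H\<^sup>2 + ?H2) / b - ?H / b\<^sup>2"
    using assms by (simp add: field_simps power2_eq_square)
  finally show ?thesis .
qed

section \<open>Partial fractions\<close>

text \<open>
  The left-hand side is the $m$-th difference of $1/x$ up to sign: by Pascal's rule, its value
  for $m + 1$ at $x$ is the difference of its values for $m$ at $x$ and $x + 1$.
\<close>

lemma alternating_binomial_partial_fraction:
  assumes "x > (0 :: real)"
  shows "(\<Sum>r\<le>m. (-1) ^ r * real (m choose r) / (x + real r)) = fact m / pochhammer x (Suc m)"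
  using assms
proof (induction m arbitrary: x)
  case 0
  thus ?case by simp
next
  case (Suc m)
  let ?P = "\<lambda>m x. \<Sum>r\<le>m. (-1) ^ r * real (m choose r) / (x + real r)"
  have "?P (Suc m) x = 1 / x + (\<Sum>r\<le>m. (-1) ^ Suc r * real (Suc m choose Suc r) / (x + real (Suc r)))"
    by (subst sum.atMost_Suc_shift) simp
  also have "\<dots> = 1 / x + (\<Sum>r\<le>m. (-1) ^ Suc r * real (m choose Suc r) / (x + real (Suc r)))
                  - ?P m (x + 1)"
    by (simp add: sum_subtractf [symmetric] sum.distrib [symmetric] algebra_simps add_divide_distrib
          diff_divide_distrib sum_negf [symmetric])
  also have "1 / x + (\<Sum>r\<le>m. (-1) ^ Suc r * real (m choose Suc r) / (x + real (Suc r))) = ?P m x"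
    using sum.atMost_Suc_shift[of "\<lambda>r. (-1) ^ r * real (m choose r) / (x + real r)" m]
    by (simp add: binomial_eq_0)
  also have "?P m x - ?P m (x + 1) = fact m / pochhammer x (Suc m) - fact m / pochhammer (x + 1) (Suc m)"
    using Suc.IH[of x] Suc.IH[of "x + 1"] Suc.prems by simp
  also have "\<dots> = fact (Suc m) / pochhammer x (Suc (Suc m))"
  proof -
    define q where "q = pochhammer (x + 1) m"
    have q: "q > 0" unfolding q_def using Suc.prems by (intro pochhammer_pos) simp
    have "pochhammer x (Suc m) = x * q"
      by (simp add: q_def pochhammer_rec)
    moreover have "pochhammer (x + 1) (Suc m) = q * (x + 1 + real m)"
      by (simp add: q_def pochhammer_Suc)
    moreover have "pochhammer x (Suc (Suc m)) = x * (q * (x + 1 + real m))"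
      by (subst pochhammer_rec) (simp add: q_def pochhammer_Suc)
    moreover have "F / (x * q) - F / (q * y) = (y - x) * F / (x * (q * y))" if "y > 0" for F y :: real
      using that q Suc.prems by (simp add: field_simps)
    ultimately show ?thesis
      using Suc.prems by (simp add: add.commute)
  qed
  finally show ?case .
qed

text \<open>
  For $k \ge 2$ the coefficients add up to 0, so $1/(x+1)$ can be subtracted in every term
  without changing the sum. This removes the term $r = 0$.
\<close>

lemma inverse_gbinomial_partial_fractions:
  assumes "x > (-1 :: real)" "k \<ge> 2"
  shows "1 / ((x + real k) gchoose k) =
           real k * (\<Sum>r = 1..k - 1. (-1) ^ (r + 1) * real ((k - 1) choose r) *
             (\<Sum>j = 1..r. 1 / (x + real j) - 1 / (x + real j + 1)))"
proof -
  define m where "m = k - 1"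
  have k: "k = Suc m" and m: "m > 0" using assms by (auto simp: m_def)
  define c where "c = (\<lambda>r. (-1) ^ r * real (m choose r))"
  have telescope: "(\<Sum>j = 1..r. 1 / (x + real j) - 1 / (x + real j + 1))
                     = 1 / (x + 1) - 1 / (x + 1 + real r)" for r
    by (induction r) (simp_all add: add_ac)
  have "1 / ((x + real k) gchoose k) = real k * (fact m / pochhammer (x + 1) (Suc m))"
    by (simp add: k gbinomial_pochhammer' algebra_simps)
  also have "fact m / pochhammer (x + 1) (Suc m) = (\<Sum>r\<le>m. c r / (x + 1 + real r))"
    using assms alternating_binomial_partial_fraction[of "x + 1" m] by (simp add: c_def)
  also have "\<dots> = (\<Sum>r\<le>m. c r / (x + 1 + real r)) - (\<Sum>r\<le>m. c r) / (x + 1)"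
    using m choose_alternating_sum[of m, where 'a = real] by (simp add: c_def)
  also have "\<dots> = (\<Sum>r\<le>m. - c r * (1 / (x + 1) - 1 / (x + 1 + real r)))"
    by (simp add: sum_divide_distrib algebra_simps flip: sum_subtractf)
  also have "\<dots> = (\<Sum>r = 1..m. - c r * (1 / (x + 1) - 1 / (x + 1 + real r)))"
    by (intro sum.mono_neutral_right) (auto simp: not_le)
  also have "\<dots> = (\<Sum>r = 1..m. (-1) ^ (r + 1) * real (m choose r) *
             (\<Sum>j = 1..r. 1 / (x + real j) - 1 / (x + real j + 1)))"
    unfolding telescope by (simp add: c_def)
  finally show ?thesis by (simp add: m_def)
qed

section \<open>The series with binomial denominators\<close>

text \<open>
  Writing each $H_{a+j}$ as $H_{a+1}$ plus a finite sum of reciprocals gives the two negative terms of the closed form.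
\<close>

lemma sum_shifted_harm_over_square:
  assumes "a \<ge> (0 :: real)"
  shows "(\<Sum>j = 1..r. shifted_harm (a + real j) / (a + real j)\<^sup>2) =
           shifted_harm (a + 1) * parametric_harm r 2 a
             + (\<Sum>i = 1..r - 1. parametric_harm i 1 (a + 1) / (real i + a + 1)\<^sup>2)"
proof -
  have "(\<Sum>j = 1..r. shifted_harm (a + real j) / (a + real j)\<^sup>2)
          = (\<Sum>i<r. shifted_harm (a + 1 + real i) / (real i + a + 1)\<^sup>2)"
    by (simp add: sum.atLeast1_atMost_eq add_ac)
  also have "\<dots> = (\<Sum>i<r. shifted_harm (a + 1) * (1 / (real (Suc i) + a)\<^sup>2)
                        + parametric_harm i 1 (a + 1) / (real i + a + 1)\<^sup>2)"
    using assms by (simp only: shifted_harm_add_nat) (simp add: add_divide_distrib add_ac)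
  also have "\<dots> = shifted_harm (a + 1) * (\<Sum>i<r. 1 / (real (Suc i) + a)\<^sup>2)
                    + (\<Sum>i<r. parametric_harm i 1 (a + 1) / (real i + a + 1)\<^sup>2)"
    by (simp add: sum.distrib sum_distrib_left)
  also have "(\<Sum>i<r. 1 / (real (Suc i) + a)\<^sup>2) = parametric_harm r 2 a"
    using assms by (simp add: parametric_harm_2_eq sum.atLeast1_atMost_eq)
  also have "(\<Sum>i<r. parametric_harm i 1 (a + 1) / (real i + a + 1)\<^sup>2) =
               (\<Sum>i = 1..r - 1. parametric_harm i 1 (a + 1) / (real i + a + 1)\<^sup>2)"
    by (intro sum.mono_neutral_right) (auto simp: parametric_harm_def not_le)
  finally show ?thesis .
qed

theorem theorem4p4:
  fixes a :: real and k :: nat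
  assumes "a \<ge> 0" and "k \<ge> 2"
  shows "(\<lambda>n. (harm (Suc n))\<^sup>2 / ((real (Suc n) + real k + a) gchoose k)) sums
    (real k * (\<Sum>r = 1..k - 1. (-1) ^ (r + 1) * real ((k - 1) choose r) *
      (riemann_zeta 2 * parametric_harm r 1 a
       - shifted_harm (a + 1) * parametric_harm r 2 a
       - (\<Sum>i = 1..r - 1. parametric_harm i 1 (a + 1) / (real i + a + 1)\<^sup>2)
       + (\<Sum>j = 1..r. ((shifted_harm (a + real j))\<^sup>2 + shifted_harm2 (a + real j)) / (a + real j)))))"
proof -
  define t where "t = (\<lambda>n j. (harm (Suc n))\<^sup>2 *
    (1 / (real (Suc n) + (a + real j)) - 1 / (real (Suc n) + (a + real j) + 1)))"
  define T :: "real \<Rightarrow> real" where "T = (\<lambda>b. (riemann_zeta 2 + (shifted_harm b)\<^sup>2 + shifted_harm2 b) / b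
    - shifted_harm b / b\<^sup>2)"
  have "(\<lambda>n. t n j) sums T (a + real j)" if "j \<ge> 1" for j
    unfolding t_def T_def using assms that by (intro harm_square_telescoping_sums) auto
  hence "(\<lambda>n. real k * (\<Sum>r = 1..k - 1. (-1) ^ (r + 1) * real ((k - 1) choose r) *
             (\<Sum>j = 1..r. t n j))) sums
         (real k * (\<Sum>r = 1..k - 1. (-1) ^ (r + 1) * real ((k - 1) choose r) *
             (\<Sum>j = 1..r. T (a + real j))))"
    by (intro sums_mult sums_sum) auto
  also have "(\<lambda>n. real k * (\<Sum>r = 1..k - 1. (-1) ^ (r + 1) * real ((k - 1) choose r) *
             (\<Sum>j = 1..r. t n j)))
         = (\<lambda>n. (harm (Suc n))\<^sup>2 / ((real (Suc n) + real k + a) gchoose k))"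
  proof
    fix n
    define h where "h = (harm (Suc n) :: real)"
    have "h\<^sup>2 / ((real (Suc n) + real k + a) gchoose k)
            = h\<^sup>2 * (1 / ((real (Suc n) + a + real k) gchoose k))"
      by (simp add: add_ac)
    also have "\<dots> = h\<^sup>2 * (real k * (\<Sum>r = 1..k - 1. (-1) ^ (r + 1) * real ((k - 1) choose r) *
        (\<Sum>j = 1..r. 1 / (real (Suc n) + a + real j) - 1 / (real (Suc n) + a + real j + 1))))"
      using assms by (subst inverse_gbinomial_partial_fractions) auto
    also have "\<dots> = real k * (\<Sum>r = 1..k - 1. (-1) ^ (r + 1) * real ((k - 1) choose r) *
             (\<Sum>j = 1..r. t n j))"
      unfolding t_def h_def[symmetric] by (simp add: sum_distrib_left mult_ac add_ac)
    finally show "real k * (\<Sum>r = 1..k - 1. (-1) ^ (r + 1) * real ((k - 1) choose r) *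
             (\<Sum>j = 1..r. t n j)) = (harm (Suc n))\<^sup>2 / ((real (Suc n) + real k + a) gchoose k)"
      unfolding h_def by simp
  qed
  also have "(\<lambda>r. \<Sum>j = 1..r. T (a + real j)) = (\<lambda>r. riemann_zeta 2 * parametric_harm r 1 a
       - shifted_harm (a + 1) * parametric_harm r 2 a
       - (\<Sum>i = 1..r - 1. parametric_harm i 1 (a + 1) / (real i + a + 1)\<^sup>2)
       + (\<Sum>j = 1..r. ((shifted_harm (a + real j))\<^sup>2 + shifted_harm2 (a + real j)) / (a + real j)))"
  proof
    fix r
    have "(\<Sum>j = 1..r. T (a + real j)) = riemann_zeta 2 * (\<Sum>j = 1..r. 1 / (real j + a))
        + (\<Sum>j = 1..r. ((shifted_harm (a + real j))\<^sup>2 + shifted_harm2 (a + real j)) / (a + real j))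
        - (\<Sum>j = 1..r. shifted_harm (a + real j) / (a + real j)\<^sup>2)"
      by (simp add: T_def sum_subtractf sum.distrib add_divide_distrib sum_distrib_left add_ac)
    thus "(\<Sum>j = 1..r. T (a + real j)) = riemann_zeta 2 * parametric_harm r 1 a
       - shifted_harm (a + 1) * parametric_harm r 2 a
       - (\<Sum>i = 1..r - 1. parametric_harm i 1 (a + 1) / (real i + a + 1)\<^sup>2)
       + (\<Sum>j = 1..r. ((shifted_harm (a + real j))\<^sup>2 + shifted_harm2 (a + real j)) / (a + real j))"
      using assms(1) sum_shifted_harm_over_square[OF assms(1), of r] parametric_harm_1_eq[of a r]
      by simp
  qed
  finally show ?thesis .
qed

end
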